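(* Let $T>0$. For $i=1,2$ let $H_i\in(0,1)$, $K_i\in(0,2)$ with $H_iK_i\in(0,1)$, and let $\{X^i(t),\,0\le t\le T\}$ be a bifractional Brownian motion with Hurst indices $(H_i,K_i)$. Let $\gamma_i=\gamma(H_i,K_i)$, where $$\gamma(H,K)=\max\left(\frac{1}{2-2HK},\,1\right)\ \text{ if } K\in(0,1],\qquad \gamma(H,K)=\frac{1}{\min(1,2H)+1-2HK}\ \text{ if } K\in(1,2).$$ Suppose that $\gamma_1=\gamma_2$ and that $K_1\neq K_2$. Let $P_i^T$ be the probability measure generated by the process $X^i$ on the interval $[0,T]$, $i=1,2$. Then the probability measures $P_1^T$ and $P_2^T$ are singular with respect to each other.
   Context: A bifractional Brownian motion on $[0,T]$ with Hurst indices $(H,K)$, where $H\in(0,1)$, $K\in(0,2)$ and $HK\in(0,1)$, is a centered Gaussian process $\{B^{H,K}_t,\ t\in[0,T]\}$ starting from zero with covariance function $$R^{H,K}(t,s)=\frac{1}{2^K}\left((t^{2H}+s^{2H})^K-|t-s|^{2HK}\right),\qquad 0\le s,t\le T.$$ The probability measure generated by a process $\{X(t),\,t\in[0,T]\}$ is its law on the path space $\mathbb{R}^{[0,T]}$ equipped with the $\sigma$-algebra generated by the coordinate maps. Two probability measures $P,Q$ on the same measurable space are singular with respect to each other if there is a measurable set $A$ with $P(A)=1$ and $Q(A)=0$. *)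

theory Defs
  imports "HOL-Probability.Probability"
begin

text \<open>Gaussian random variables may be degenerate: the case \<open>\<sigma> = 0\<close> is the point mass at \<open>\<mu>\<close>.
  (It is needed, since the process below vanishes at time 0.)\<close>

definition gaussian_rv :: "'a measure \<Rightarrow> ('a \<Rightarrow> real) \<Rightarrow> bool" where
  "gaussian_rv M Y \<longleftrightarrow> Y \<in> borel_measurable M \<and>
     (\<exists>\<mu> \<sigma>. 0 \<le> \<sigma> \<and>
        (if \<sigma> = 0 then AE \<omega> in M. Y \<omega> = \<mu>
         else distributed M lborel Y (\<lambda>x. ennreal (normal_density \<mu> \<sigma> x))))"

text \<open>A process is Gaussian if its finite-dimensional distributions are (possibly degenerate)
  multivariate normal, i.e. if all finite linear combinations of its coordinates are Gaussian.\<close>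

definition gaussian_process :: "'a measure \<Rightarrow> 'i set \<Rightarrow> ('i \<Rightarrow> 'a \<Rightarrow> real) \<Rightarrow> bool" where
  "gaussian_process M I X \<longleftrightarrow> prob_space M \<and>
     (\<forall>J c. finite J \<longrightarrow> J \<subseteq> I \<longrightarrow> gaussian_rv M (\<lambda>\<omega>. \<Sum>t\<in>J. c t * X t \<omega>))"

definition covariance :: "'a measure \<Rightarrow> ('a \<Rightarrow> real) \<Rightarrow> ('a \<Rightarrow> real) \<Rightarrow> real" where
  "covariance M Y Z =
     (LINT \<omega>|M. (Y \<omega> - (LINT \<omega>'|M. Y \<omega>')) * (Z \<omega> - (LINT \<omega>'|M. Z \<omega>')))"

definition bifbm_cov :: "real \<Rightarrow> real \<Rightarrow> real \<Rightarrow> real \<Rightarrow> real" where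
  "bifbm_cov H K t s =
     1 / 2 powr K *
     ((t powr (2 * H) + s powr (2 * H)) powr K - \<bar>t - s\<bar> powr (2 * H * K))"

text \<open>Only the values \<open>X t\<close> for \<open>t \<in> {0..T}\<close> matter. Starting from zero is
  required almost surely.\<close>

definition bifractional_brownian_motion ::
  "'a measure \<Rightarrow> real \<Rightarrow> real \<Rightarrow> real \<Rightarrow> (real \<Rightarrow> 'a \<Rightarrow> real) \<Rightarrow> bool" where
  "bifractional_brownian_motion M T H K X \<longleftrightarrow>
     gaussian_process M {0..T} X \<and>
     (\<forall>t\<in>{0..T}. (LINT \<omega>|M. X t \<omega>) = 0) \<and>
     (AE \<omega> in M. X 0 \<omega> = 0) \<and>
     (\<forall>t\<in>{0..T}. \<forall>s\<in>{0..T}. covariance M (X t) (X s) = bifbm_cov H K t s)"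

text \<open>The path space over \<open>I\<close> is the product of copies of the Borel space of reals: its elements
  are the functions on \<open>I\<close> (extended by \<open>undefined\<close>), and its \<open>\<sigma>\<close>-algebra is generated by the
  coordinate maps.\<close>

definition process_law :: "'a measure \<Rightarrow> 'i set \<Rightarrow> ('i \<Rightarrow> 'a \<Rightarrow> real) \<Rightarrow> ('i \<Rightarrow> real) measure" where
  "process_law M I X = distr M (PiM I (\<lambda>_. borel)) (\<lambda>\<omega>. \<lambda>t\<in>I. X t \<omega>)"

definition mutually_singular :: "'a measure \<Rightarrow> 'a measure \<Rightarrow> bool" where
  "mutually_singular P Q \<longleftrightarrow> prob_space P \<and> prob_space Q \<and> sets P = sets Q \<and>
     (\<exists>A\<in>sets P. measure P A = 1 \<and> measure Q A = 0)"

definition bifbm_gamma :: "real \<Rightarrow> real \<Rightarrow> real" where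
  "bifbm_gamma H K =
     (if K \<le> 1 then max (1 / (2 - 2 * H * K)) 1
      else 1 / (min 1 (2 * H) + 1 - 2 * H * K))"

end

theory Submission
  imports Defs "HOL-Real_Asymp.Real_Asymp"
begin

text \<open>
  Bifractional Brownian motion is self-similar with index \<open>h = H K\<close>, and its behaviour near time 0
  already reveals both \<open>h\<close> and \<open>K\<close>.  For singularity it suffices to find events whose probability is
  arbitrarily close to 1 under one law and to 0 under the other (\<open>mutually_singularI_approx\<close>).

  If \<open>h\<^sub>1 < h\<^sub>2\<close>, choose \<open>h\<close> strictly between them.  The standard deviation of \<open>X t\<close> is
  \<open>t powr (H K)\<close>, so for small \<open>t\<close> the event \<open>\<bar>X t\<bar> > t powr h\<close> has probability close to 1 under
  the first law, by the bound on a Gaussian density, and close to 0 under the second, by Chebyshev's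
  inequality (\<open>mutually_singular_of_index_less\<close>).

  If \<open>h\<^sub>1 = h\<^sub>2 = h\<close>, fix \<open>c\<close> in \<open>(0, 1)\<close> and look at the rescaled increments
  \<open>(X t - X (c t)) / t powr h\<close> along the times \<open>t = T, T x, T x\<^sup>2, \<dots>\<close>.  By self-similarity they
  all have the same variance, namely that of \<open>X 1 - X c\<close>.  For small \<open>x\<close> they are nearly
  uncorrelated, since the covariance of \<open>X 1\<close> and \<open>X x\<close> is \<open>o(x powr h)\<close> as \<open>x\<close> tends to 0
  (\<open>bifbm_cov_one_tendsto_0\<close>).  For centred Gaussian variables, small correlations imply small
  correlations of the squares, so the empirical mean of the squared increments concentrates at this
  variance (\<open>mean_square_incr_concentration\<close>).  As \<open>x\<close> tends to 0, the variance of
  \<open>X 1 - X (1 - x)\<close> is asymptotic to \<open>2 powr (1 - K) * x powr (2 h)\<close>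
  (\<open>incr_var_asymptotic\<close>).  Hence for \<open>K\<^sub>1 \<noteq> K\<^sub>2\<close> some \<open>c\<close> gives two different limits, and the
  empirical mean separates the two laws (\<open>mutually_singular_of_index_eq\<close>).
\<close>

section \<open>Mutual singularity\<close>

lemma mutually_singular_commute:
  assumes "mutually_singular P Q"
  shows "mutually_singular Q P"
proof -
  from assms obtain A where A: "A \<in> sets P" "measure P A = 1" "measure Q A = 0"
    and PQ: "prob_space P" "prob_space Q" "sets P = sets Q"
    by (auto simp: mutually_singular_def)
  interpret P: prob_space P by fact
  interpret Q: prob_space Q by fact
  have "space P - A \<in> sets Q" "measure P (space P - A) = 0"
    using A PQ by (auto simp: P.prob_compl)
  moreover have "measure Q (space P - A) = 1"
    using A PQ Q.prob_compl[of A] sets_eq_imp_space_eq[OF PQ(3)] by auto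
  ultimately show ?thesis
    using PQ by (auto simp: mutually_singular_def)
qed

text \<open>Choosing \<open>A n\<close> for \<open>\<epsilon> = 1 / 2 ^ n\<close> makes the exceptional probabilities summable under both measures.
  By the Borel--Cantelli lemma the set of points lying in \<open>A n\<close> for all large \<open>n\<close> then has full
  measure under \<open>P\<close> and measure zero under \<open>Q\<close>.\<close>

lemma mutually_singularI_approx:
  assumes P: "prob_space P" and Q: "prob_space Q" and sets: "sets P = sets Q"
    and approx: "\<And>\<epsilon>. 0 < \<epsilon> \<Longrightarrow> \<exists>A\<in>sets P. 1 - \<epsilon> \<le> measure P A \<and> measure Q A \<le> \<epsilon>"
  shows "mutually_singular P Q"
proof -
  interpret P: prob_space P by fact
  interpret Q: prob_space Q by fact
  have "\<exists>A\<in>sets P. 1 - (1 / 2) ^ n \<le> measure P A \<and> measure Q A \<le> (1 / 2) ^ n" for n :: nat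
    by (rule approx) simp
  then obtain A where A [measurable]: "\<And>n. A n \<in> sets P"
    and AP: "\<And>n. 1 - (1 / 2) ^ n \<le> measure P (A n)" and AQ: "\<And>n::nat. measure Q (A n) \<le> (1 / 2) ^ n"
    by metis
  have A' [measurable]: "A n \<in> sets Q" for n using A sets by simp
  have geo: "summable (\<lambda>n. (1 / 2 :: real) ^ n)" by simp
  define B where "B = {\<omega>\<in>space P. \<forall>\<^sub>F n in sequentially. \<omega> \<in> A n}"
  have B: "B \<in> sets P" unfolding B_def eventually_sequentially by measurable
  have "AE \<omega> in P. \<forall>\<^sub>F n in sequentially. \<omega> \<in> space P - (space P - A n)"
  proof (rule borel_cantelli_AE1)
    show "summable (\<lambda>n. measure P (space P - A n))"
      by (rule summable_comparison_test[OF _ geo]) (use AP in \<open>auto simp: P.prob_compl algebra_simps\<close>)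
  qed (auto simp: P.emeasure_finite less_top[symmetric])
  then have "AE \<omega> in P. \<omega> \<in> B"
    by (rule AE_mp) (auto intro!: AE_I2 simp: B_def elim: eventually_mono)
  then have "measure P B = 1" using B by (simp add: P.prob_eq_1)
  moreover have "AE \<omega> in Q. \<forall>\<^sub>F n in sequentially. \<omega> \<in> space Q - A n"
  proof (rule borel_cantelli_AE1)
    show "summable (\<lambda>n. measure Q (A n))"
      by (rule summable_comparison_test[OF _ geo]) (use AQ in auto)
  qed (auto simp: Q.emeasure_finite less_top[symmetric])
  then have "AE \<omega> in Q. \<omega> \<notin> B"
  proof (rule AE_mp, intro AE_I2 impI notI)
    fix \<omega> assume "\<forall>\<^sub>F n in sequentially. \<omega> \<in> space Q - A n" "\<omega> \<in> B"
    then have "\<forall>\<^sub>F n in sequentially. \<omega> \<in> space Q - A n" "\<forall>\<^sub>F n in sequentially. \<omega> \<in> A n"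
      by (auto simp only: B_def mem_Collect_eq)
    then have "\<forall>\<^sub>F n :: nat in sequentially. False" by eventually_elim auto
    then show False by simp
  qed
  then have "measure Q B = 0" using B sets by (simp add: Q.prob_eq_0)
  ultimately show ?thesis
    using P Q sets B by (auto simp: mutually_singular_def)
qed

section \<open>Moments and concentration of centred Gaussian variables\<close>

lemma gaussian_rv_measurable: "gaussian_rv M Y \<Longrightarrow> Y \<in> borel_measurable M"
  by (simp add: gaussian_rv_def)

lemma (in prob_space) gaussian_rv_cases:
  assumes "gaussian_rv M Y" and "expectation Y = 0"
  obtains (null) "AE \<omega> in M. Y \<omega> = 0"
    | (normal) \<sigma> where "0 < \<sigma>" "distributed M lborel Y (\<lambda>x. ennreal (normal_density 0 \<sigma> x))"
proof -
  from assms obtain \<mu> \<sigma> where \<sigma>: "0 \<le> \<sigma>" and *: "if \<sigma> = 0 then AE \<omega> in M. Y \<omega> = \<mu>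
         else distributed M lborel Y (\<lambda>x. ennreal (normal_density \<mu> \<sigma> x))"
    and Y [measurable]: "Y \<in> borel_measurable M"
    by (auto simp: gaussian_rv_def)
  show ?thesis
  proof (cases "\<sigma> = 0")
    case True
    then have AE: "AE \<omega> in M. Y \<omega> = \<mu>" using * by simp
    then have "expectation Y = expectation (\<lambda>_. \<mu>)" by (intro integral_cong_AE) auto
    then show ?thesis using AE assms(2) null by (simp add: prob_space)
  next
    case False
    then have D: "distributed M lborel Y (\<lambda>x. ennreal (normal_density \<mu> \<sigma> x))" using * by simp
    have "\<mu> = expectation Y"
      using distributed_integral[OF D, of "\<lambda>x. x"] False \<sigma> integral_normal_moment_nz_1[of \<sigma> \<mu>] by simp
    then show ?thesis using D assms(2) False \<sigma> normal[of \<sigma>] by simp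
  qed
qed

lemma (in prob_space) gaussian_rv_moments:
  assumes "gaussian_rv M Y" and "expectation Y = 0"
  shows integrable_gaussian_power: "integrable M (\<lambda>\<omega>. Y \<omega> ^ k)"
    and gaussian_fourth_moment: "expectation (\<lambda>\<omega>. Y \<omega> ^ 4) = 3 * (expectation (\<lambda>\<omega>. Y \<omega> ^ 2))\<^sup>2"
proof -
  note [measurable] = gaussian_rv_measurable[OF assms(1)]
  have "integrable M (\<lambda>\<omega>. Y \<omega> ^ k) \<and>
      expectation (\<lambda>\<omega>. Y \<omega> ^ 4) = 3 * (expectation (\<lambda>\<omega>. Y \<omega> ^ 2))\<^sup>2"
    using assms
  proof (cases rule: gaussian_rv_cases)
    case null
    have "expectation (\<lambda>\<omega>. Y \<omega> ^ j) = expectation (\<lambda>_. 0 ^ j)" for j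
      by (rule integral_cong_AE) (use null in auto)
    moreover have "integrable M (\<lambda>\<omega>. Y \<omega> ^ k) \<longleftrightarrow> integrable M (\<lambda>_. (0::real) ^ k)"
      by (rule integrable_cong_AE) (use null in auto)
    ultimately show ?thesis by simp
  next
    case (normal \<sigma>)
    have "integrable M (\<lambda>\<omega>. Y \<omega> ^ k)"
      using distributed_integrable[OF normal(2), of "\<lambda>x. x ^ k"]
        integrable_normal_moment[OF normal(1), of 0 k] by simp
    moreover have "expectation (\<lambda>\<omega>. Y \<omega> ^ (2 * j)) = fact (2 * j) / ((2 / \<sigma>\<^sup>2)^j * fact j)" for j
      using distributed_integral[OF normal(2), of "\<lambda>x. x ^ (2 * j)"]
        integral_normal_moment_even[OF normal(1), of 0 j] by simp
    from this[of 1] this[of 2]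
    have "expectation (\<lambda>\<omega>. Y \<omega> ^ 4) = 3 * (expectation (\<lambda>\<omega>. Y \<omega> ^ 2))\<^sup>2"
      using normal(1) by (simp add: fact_numeral power2_eq_square field_simps)
    ultimately show ?thesis by simp
  qed
  then show "integrable M (\<lambda>\<omega>. Y \<omega> ^ k)"
    "expectation (\<lambda>\<omega>. Y \<omega> ^ 4) = 3 * (expectation (\<lambda>\<omega>. Y \<omega> ^ 2))\<^sup>2" by auto
qed

definition centred_gaussian :: "'a measure \<Rightarrow> ('a \<Rightarrow> real) \<Rightarrow> bool" where
  "centred_gaussian M Y \<longleftrightarrow> gaussian_rv M Y \<and> (LINT \<omega>|M. Y \<omega>) = 0"

text \<open>The last identity is the case of Isserlis' theorem in which each of two variables occurs twice.  By
  polarization, \<open>12 u\<^sup>2 v\<^sup>2 = (u + v)\<^sup>4 + (u - v)\<^sup>4 - 2 u\<^sup>4 - 2 v\<^sup>4\<close>, and each fourth moment on the right is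
  three times a squared variance.\<close>

lemma (in prob_space) gaussian_product_moments:
  fixes U V :: "'a \<Rightarrow> real"
  assumes "centred_gaussian M U" "centred_gaussian M V"
    "centred_gaussian M (\<lambda>\<omega>. U \<omega> + V \<omega>)" "centred_gaussian M (\<lambda>\<omega>. U \<omega> - V \<omega>)"
  shows integrable_gaussian_prod: "integrable M (\<lambda>\<omega>. U \<omega> * V \<omega>)"
    and integrable_gaussian_square_prod: "integrable M (\<lambda>\<omega>. (U \<omega>)\<^sup>2 * (V \<omega>)\<^sup>2)"
    and gaussian_square_prod: "expectation (\<lambda>\<omega>. (U \<omega>)\<^sup>2 * (V \<omega>)\<^sup>2) =
      expectation (\<lambda>\<omega>. (U \<omega>)\<^sup>2) * expectation (\<lambda>\<omega>. (V \<omega>)\<^sup>2) + 2 * (expectation (\<lambda>\<omega>. U \<omega> * V \<omega>))\<^sup>2"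
proof -
  have I: "integrable M (\<lambda>\<omega>. Y \<omega> ^ k)" and F: "expectation (\<lambda>\<omega>. Y \<omega> ^ 4) = 3 * (expectation (\<lambda>\<omega>. Y \<omega> ^ 2))\<^sup>2"
    if "centred_gaussian M Y" for Y and k :: nat
    using gaussian_rv_moments[of Y] that by (auto simp: centred_gaussian_def)
  note I [OF assms(1), simp] I [OF assms(2), simp] I [OF assms(3), simp] I [OF assms(4), simp]
  have prod: "U \<omega> * V \<omega> = ((U \<omega> + V \<omega>)\<^sup>2 - (U \<omega> - V \<omega>)\<^sup>2) / 4" for \<omega>
    by (simp add: power2_eq_square algebra_simps)
  show int [simp]: "integrable M (\<lambda>\<omega>. U \<omega> * V \<omega>)"
    unfolding prod by simp
  have sqprod: "(U \<omega>)\<^sup>2 * (V \<omega>)\<^sup>2 = ((U \<omega> + V \<omega>) ^ 4 + (U \<omega> - V \<omega>) ^ 4 - 2 * U \<omega> ^ 4 - 2 * V \<omega> ^ 4) / 12" for \<omega>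
    by (simp add: power4_eq_xxxx power2_eq_square algebra_simps)
  show "integrable M (\<lambda>\<omega>. (U \<omega>)\<^sup>2 * (V \<omega>)\<^sup>2)"
    unfolding sqprod by simp
  define a b r where "a = expectation (\<lambda>\<omega>. (U \<omega>)\<^sup>2)" and "b = expectation (\<lambda>\<omega>. (V \<omega>)\<^sup>2)"
    and "r = expectation (\<lambda>\<omega>. U \<omega> * V \<omega>)"
  have "expectation (\<lambda>\<omega>. (U \<omega> + V \<omega>)\<^sup>2) = expectation (\<lambda>\<omega>. (U \<omega>)\<^sup>2 + (V \<omega>)\<^sup>2 + 2 * (U \<omega> * V \<omega>))"
    by (simp add: power2_sum mult.assoc)
  also have "\<dots> = a + b + 2 * r"
    by (simp add: a_def b_def r_def)
  finally have p: "expectation (\<lambda>\<omega>. (U \<omega> + V \<omega>)\<^sup>2) = a + b + 2 * r" .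
  have "expectation (\<lambda>\<omega>. (U \<omega> - V \<omega>)\<^sup>2) = expectation (\<lambda>\<omega>. (U \<omega>)\<^sup>2 + (V \<omega>)\<^sup>2 - 2 * (U \<omega> * V \<omega>))"
    by (simp add: power2_diff mult.assoc)
  also have "\<dots> = a + b - 2 * r"
    by (simp add: a_def b_def r_def)
  finally have m: "expectation (\<lambda>\<omega>. (U \<omega> - V \<omega>)\<^sup>2) = a + b - 2 * r" .
  have "expectation (\<lambda>\<omega>. (U \<omega>)\<^sup>2 * (V \<omega>)\<^sup>2)
      = (3 * (a + b + 2 * r)\<^sup>2 + 3 * (a + b - 2 * r)\<^sup>2 - 2 * (3 * a\<^sup>2) - 2 * (3 * b\<^sup>2)) / 12"
    unfolding sqprod by (simp add: assms F p m a_def[symmetric] b_def[symmetric])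
  also have "\<dots> = a * b + 2 * r\<^sup>2"
    by (simp add: power2_eq_square algebra_simps)
  finally show "expectation (\<lambda>\<omega>. (U \<omega>)\<^sup>2 * (V \<omega>)\<^sup>2) =
      expectation (\<lambda>\<omega>. (U \<omega>)\<^sup>2) * expectation (\<lambda>\<omega>. (V \<omega>)\<^sup>2) + 2 * (expectation (\<lambda>\<omega>. U \<omega> * V \<omega>))\<^sup>2"
    by (simp add: a_def b_def r_def)
qed

text \<open>Chebyshev's inequality for the empirical mean of the \<open>(D i)\<^sup>2\<close>.  The covariance of \<open>(D i)\<^sup>2\<close> and
  \<open>(D j)\<^sup>2\<close> is twice the squared covariance of \<open>D i\<close> and \<open>D j\<close>; the \<open>n\<close> diagonal pairs account for the
  first summand of the bound, the other pairs for the second.\<close>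

lemma (in prob_space) gaussian_mean_square_concentration:
  fixes D :: "nat \<Rightarrow> 'a \<Rightarrow> real"
  assumes D: "\<And>i. i < n \<Longrightarrow> centred_gaussian M (D i)"
    and sum: "\<And>i j. i < n \<Longrightarrow> j < n \<Longrightarrow> centred_gaussian M (\<lambda>\<omega>. D i \<omega> + D j \<omega>)"
    and diff: "\<And>i j. i < n \<Longrightarrow> j < n \<Longrightarrow> centred_gaussian M (\<lambda>\<omega>. D i \<omega> - D j \<omega>)"
    and var: "\<And>i. i < n \<Longrightarrow> expectation (\<lambda>\<omega>. (D i \<omega>)\<^sup>2) = v"
    and cov: "\<And>i j. i < j \<Longrightarrow> j < n \<Longrightarrow> \<bar>expectation (\<lambda>\<omega>. D i \<omega> * D j \<omega>)\<bar> \<le> \<delta>"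
    and "0 < n" "0 < e"
  shows "prob {\<omega>\<in>space M. e \<le> \<bar>(\<Sum>i<n. (D i \<omega>)\<^sup>2) / n - v\<bar>} \<le> (2 * v\<^sup>2 / n + 2 * \<delta>\<^sup>2) / e\<^sup>2"
proof -
  define r where "r i j = expectation (\<lambda>\<omega>. D i \<omega> * D j \<omega>)" for i j
  have meas [measurable]: "D i \<in> borel_measurable M" if "i < n" for i
    using D[OF that] by (simp add: centred_gaussian_def gaussian_rv_def)
  have sq [simp]: "integrable M (\<lambda>\<omega>. (D i \<omega>)\<^sup>2)" if "i < n" for i
    using integrable_gaussian_power D[OF that] by (auto simp: centred_gaussian_def)
  have prod [simp]: "integrable M (\<lambda>\<omega>. (D i \<omega>)\<^sup>2 * (D j \<omega>)\<^sup>2)" if "i < n" "j < n" for i j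
    using that by (intro integrable_gaussian_square_prod D sum diff)
  define Z where "Z i \<omega> = (D i \<omega>)\<^sup>2 - v" for i \<omega>
  have Zprod: "Z i \<omega> * Z j \<omega> = (D i \<omega>)\<^sup>2 * (D j \<omega>)\<^sup>2 - v * (D i \<omega>)\<^sup>2 - v * (D j \<omega>)\<^sup>2 + v * v" for i j \<omega>
    by (simp add: Z_def algebra_simps)
  have Zint: "integrable M (\<lambda>\<omega>. Z i \<omega> * Z j \<omega>)" if "i < n" "j < n" for i j
    unfolding Zprod using that by simp
  have Zexp: "expectation (\<lambda>\<omega>. Z i \<omega> * Z j \<omega>) = 2 * (r i j)\<^sup>2" if "i < n" "j < n" for i j
    unfolding Zprod using that gaussian_square_prod[OF D D sum diff, of i j]
    by (simp add: var r_def prob_space)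
  have r_sym: "r i j = r j i" for i j by (simp add: r_def mult.commute)
  have r_le: "2 * (r i j)\<^sup>2 \<le> (if i = j then 2 * v\<^sup>2 else 0) + 2 * \<delta>\<^sup>2" if "i < n" "j < n" for i j
  proof (cases "i = j")
    case True
    then show ?thesis using var[OF that(1)] by (simp add: r_def power2_eq_square)
  next
    case False
    then have "\<bar>r i j\<bar> \<le> \<delta>"
      using cov[of i j] cov[of j i] that r_sym[of i j] by (cases i j rule: linorder_cases) (auto simp: r_def)
    then have "(r i j)\<^sup>2 \<le> \<delta>\<^sup>2" by (metis abs_ge_zero power2_abs power_mono)
    then show ?thesis using False by simp
  qed
  have W: "((\<Sum>i<n. (D i \<omega>)\<^sup>2) / n - v)\<^sup>2 = (\<Sum>i<n. \<Sum>j<n. Z i \<omega> * Z j \<omega>) / n\<^sup>2" for \<omega>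
  proof -
    have "(\<Sum>i<n. (D i \<omega>)\<^sup>2) / n - v = (\<Sum>i<n. Z i \<omega>) / n"
      using \<open>0 < n\<close> by (simp add: Z_def sum_subtractf diff_divide_distrib)
    then show ?thesis
      by (simp add: power_divide power2_eq_square sum_product)
  qed
  have int: "integrable M (\<lambda>\<omega>. ((\<Sum>i<n. (D i \<omega>)\<^sup>2) / n - v)\<^sup>2)"
    unfolding W by (intro integrable_divide Bochner_Integration.integrable_sum Zint) auto
  have "expectation (\<lambda>\<omega>. ((\<Sum>i<n. (D i \<omega>)\<^sup>2) / n - v)\<^sup>2) = (\<Sum>i<n. \<Sum>j<n. 2 * (r i j)\<^sup>2) / n\<^sup>2"
    unfolding W integral_divide_zero
    by (subst Bochner_Integration.integral_sum, auto intro!: Bochner_Integration.integrable_sum Zint)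
       (auto simp: Zint Zexp Bochner_Integration.integral_sum)
  also have "\<dots> \<le> (\<Sum>i<n. \<Sum>j<n. (if i = j then 2 * v\<^sup>2 else 0) + 2 * \<delta>\<^sup>2) / n\<^sup>2"
    by (intro divide_right_mono sum_mono r_le) auto
  also have "\<dots> = 2 * v\<^sup>2 / n + 2 * \<delta>\<^sup>2"
    using \<open>0 < n\<close> by (simp add: sum.distrib power2_eq_square field_simps)
  finally have le: "expectation (\<lambda>\<omega>. ((\<Sum>i<n. (D i \<omega>)\<^sup>2) / n - v)\<^sup>2) \<le> 2 * v\<^sup>2 / n + 2 * \<delta>\<^sup>2" .
  have "{\<omega>\<in>space M. e \<le> \<bar>(\<Sum>i<n. (D i \<omega>)\<^sup>2) / n - v\<bar>}
      = {\<omega>\<in>space M. e\<^sup>2 \<le> ((\<Sum>i<n. (D i \<omega>)\<^sup>2) / n - v)\<^sup>2}"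
    using \<open>0 < e\<close> by (simp flip: abs_le_square_iff)
  also have "prob \<dots> \<le> expectation (\<lambda>\<omega>. ((\<Sum>i<n. (D i \<omega>)\<^sup>2) / n - v)\<^sup>2) / e\<^sup>2"
    using \<open>0 < e\<close> by (intro integral_Markov_inequality_measure[OF int, where A="{}"]) auto
  also have "\<dots> \<le> (2 * v\<^sup>2 / n + 2 * \<delta>\<^sup>2) / e\<^sup>2"
    by (intro divide_right_mono le) auto
  finally show ?thesis .
qed

text \<open>The density of a centred normal variable with standard deviation \<open>s\<close> is at most \<open>1 / (2 s)\<close>, because
  \<open>2 \<pi> \<ge> 4\<close>.\<close>

lemma (in prob_space) gaussian_small_ball:
  assumes "gaussian_rv M Y" "expectation Y = 0" and var: "expectation (\<lambda>\<omega>. (Y \<omega>)\<^sup>2) = s\<^sup>2"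
    and "0 < s" "0 \<le> a"
  shows "prob {\<omega>\<in>space M. \<bar>Y \<omega>\<bar> \<le> a} \<le> a / s"
  using assms(1,2)
proof (cases rule: gaussian_rv_cases)
  case null
  note [measurable] = gaussian_rv_measurable[OF assms(1)]
  have "expectation (\<lambda>\<omega>. (Y \<omega>)\<^sup>2) = expectation (\<lambda>_. 0)"
    by (rule integral_cong_AE) (use null in auto)
  then show ?thesis using var \<open>0 < s\<close> by simp
next
  case (normal \<sigma>)
  have "expectation (\<lambda>\<omega>. (Y \<omega>)\<^sup>2) = \<sigma>\<^sup>2"
    using distributed_integral[OF normal(2), of "\<lambda>x. x ^ 2"]
        integral_normal_moment_even[OF normal(1), of 0 1] normal(1) by simp
  then have \<sigma>: "\<sigma> = s" using var normal(1) \<open>0 < s\<close> by simp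
  have dens: "normal_density 0 s x \<le> 1 / (2 * s)" for x
  proof -
    have "2 * s \<le> sqrt (2 * pi * s\<^sup>2)"
      using pi_gt3 \<open>0 < s\<close> by (intro real_le_rsqrt) (simp add: power_mult_distrib mult_right_mono)
    moreover have "exp (- x\<^sup>2 / (2 * s\<^sup>2)) \<le> 1" by simp
    ultimately show ?thesis
      using \<open>0 < s\<close> by (auto simp: normal_density_def intro!: frac_le)
  qed
  have "{\<omega>\<in>space M. \<bar>Y \<omega>\<bar> \<le> a} = Y -` {-a..a} \<inter> space M" by auto
  then have "emeasure M {\<omega>\<in>space M. \<bar>Y \<omega>\<bar> \<le> a}
      = (\<integral>\<^sup>+ x. ennreal (normal_density 0 \<sigma> x) * indicator {-a..a} x \<partial>lborel)"
    using distributed_emeasure[OF normal(2), of "{-a..a}"] by simp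
  also have "\<dots> \<le> (\<integral>\<^sup>+ x. ennreal (1 / (2 * s)) * indicator {-a..a} x \<partial>lborel)"
    using dens \<sigma> by (intro nn_integral_mono mult_right_mono ennreal_leI) auto
  also have "\<dots> = ennreal (a / s)"
    using \<open>0 < s\<close> \<open>0 \<le> a\<close> by (simp add: nn_integral_cmult_indicator flip: ennreal_mult')
  finally show ?thesis
    using \<open>0 < s\<close> \<open>0 \<le> a\<close> by (simp add: emeasure_eq_measure)
qed

section \<open>The covariance function near zero and near the diagonal\<close>

lemma powr_tendsto_0_at_right:
  fixes p :: real
  assumes "0 < p"
  shows "((\<lambda>x. x powr p) \<longlongrightarrow> 0) (at_right 0)"
  using assms by real_asymp

lemma bifbm_cov_commute: "bifbm_cov H K t s = bifbm_cov H K s t"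
  by (simp add: bifbm_cov_def add.commute abs_minus_commute)

lemma bifbm_cov_scale:
  assumes "0 \<le> r" "0 \<le> t" "0 \<le> s"
  shows "bifbm_cov H K (r * t) (r * s) = r powr (2 * H * K) * bifbm_cov H K t s"
proof -
  have "\<bar>r * t - r * s\<bar> = r * \<bar>t - s\<bar>"
    using assms by (simp add: abs_mult flip: right_diff_distrib)
  moreover have "(r * t) powr (2 * H) + (r * s) powr (2 * H)
      = r powr (2 * H) * (t powr (2 * H) + s powr (2 * H))"
    using assms by (simp add: powr_mult distrib_left)
  ultimately show ?thesis
    using assms by (simp add: bifbm_cov_def powr_mult powr_powr right_diff_distrib)
qed

lemma bifbm_cov_diag:
  assumes "0 \<le> t" "K > 0"
  shows "bifbm_cov H K t t = t powr (2 * H * K)"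
proof -
  have "bifbm_cov H K t t = (2 * t powr (2 * H)) powr K / 2 powr K"
    using assms by (simp add: bifbm_cov_def flip: mult_2)
  also have "(2 * t powr (2 * H)) powr K = 2 powr K * t powr (2 * H * K)"
    by (subst powr_mult) (auto simp: powr_powr)
  also have "\<dots> / 2 powr K = t powr (2 * H * K)"
    by simp
  finally show ?thesis .
qed

text \<open>Up to the factor \<open>1 / 2 powr K\<close>, the covariance is the sum of \<open>(1 + x powr (2 H)) powr K - 1\<close>, of
  order \<open>x powr (2 H)\<close>, and \<open>1 - (1 - x) powr (2 H K)\<close>, of order \<open>x\<close>.  Both exponents exceed \<open>H K\<close>,
  the first because \<open>K < 2\<close> and the second because \<open>H K < 1\<close>.\<close>

lemma bifbm_cov_one_tendsto_0:
  assumes "0 < H" "0 < K" "K < 2" "H * K < 1"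
  shows "((\<lambda>x. bifbm_cov H K 1 x / x powr (H * K)) \<longlongrightarrow> 0) (at_right 0)"
proof -
  define a b where "a = 2 * H" and "b = 2 * H * K"
  have 1: "((\<lambda>x. ((1 + x powr a) powr K - 1) / x powr a) \<longlongrightarrow> K) (at_right 0)"
    using assms unfolding a_def by real_asymp
  have 2: "((\<lambda>x. (1 - (1 - x) powr b) / x) \<longlongrightarrow> b) (at_right 0)"
    using assms unfolding b_def by real_asymp
  have pos: "a - H * K > 0" "1 - H * K > 0"
    using assms by (auto simp: a_def mult.commute[of 2])
  have "((\<lambda>x. 1 / 2 powr K * (((1 + x powr a) powr K - 1) / x powr a * x powr (a - H * K)
            + (1 - (1 - x) powr b) / x * x powr (1 - H * K)))
          \<longlongrightarrow> 1 / 2 powr K * (K * 0 + b * 0)) (at_right 0)"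
    by (intro tendsto_intros 1 2 powr_tendsto_0_at_right pos)
  moreover have "\<forall>\<^sub>F x in at_right 0.
        1 / 2 powr K * (((1 + x powr a) powr K - 1) / x powr a * x powr (a - H * K)
            + (1 - (1 - x) powr b) / x * x powr (1 - H * K))
        = bifbm_cov H K 1 x / x powr (H * K)"
    using eventually_at_right_less[of "0::real"] eventually_at_right_real[of 0 "1::real", simplified]
  proof eventually_elim
    case (elim x)
    then have "x \<noteq> 0" "x powr a \<noteq> 0" "x powr (H * K) \<noteq> 0" "\<bar>1 - x\<bar> = 1 - x" by auto
    then have "((1 + x powr a) powr K - 1) / x powr a * x powr (a - H * K)
        = ((1 + x powr a) powr K - 1) / x powr (H * K)"
      and "(1 - (1 - x) powr b) / x * x powr (1 - H * K) = (1 - (1 - x) powr b) / x powr (H * K)"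
      using elim by (simp_all add: powr_diff)
    moreover have "bifbm_cov H K 1 x = 1 / 2 powr K * ((1 + x powr a) powr K - (1 - x) powr b)"
      using \<open>\<bar>1 - x\<bar> = 1 - x\<close> by (simp add: bifbm_cov_def a_def b_def)
    ultimately show ?case
      by (simp flip: add_divide_distrib)
  qed
  ultimately show ?thesis
    by (auto elim: Lim_transform_eventually)
qed

text \<open>By self-similarity, the covariance divided by the product of the standard deviations depends only on
  the ratio \<open>s / t\<close>.\<close>

lemma bifbm_cov_decay:
  assumes "0 < H" "0 < K" "K < 2" "H * K < 1" and "0 < \<eta>"
  obtains x\<^sub>0 where "0 < x\<^sub>0"
    "\<And>t s. 0 < s \<Longrightarrow> s < x\<^sub>0 * t \<Longrightarrow> \<bar>bifbm_cov H K t s\<bar> \<le> \<eta> * (t * s) powr (H * K)"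
proof -
  have "\<forall>\<^sub>F x in at_right 0. \<bar>bifbm_cov H K 1 x / x powr (H * K)\<bar> < \<eta>"
    using order_tendstoD(2)[OF tendsto_rabs[OF bifbm_cov_one_tendsto_0[OF assms(1-4)]]] assms(5)
    by simp
  then obtain x\<^sub>0 where x0: "0 < x\<^sub>0"
      "\<And>x. 0 < x \<Longrightarrow> x < x\<^sub>0 \<Longrightarrow> \<bar>bifbm_cov H K 1 x / x powr (H * K)\<bar> < \<eta>"
    unfolding eventually_at_right_field by auto
  show ?thesis
  proof (rule that[OF x0(1)])
    fix t s :: real assume s: "0 < s" "s < x\<^sub>0 * t"
    then have t: "t > 0" using x0(1) by (metis less_trans zero_less_mult_pos)
    define x where "x = s / t"
    have x: "0 < x" "x < x\<^sub>0" and sx: "s = t * x" using s t by (auto simp: x_def field_simps)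
    have "\<bar>bifbm_cov H K 1 x\<bar> \<le> \<eta> * x powr (H * K)"
      using x0(2)[OF x] x by (simp add: abs_divide divide_simps)
    then have "t powr (2 * H * K) * \<bar>bifbm_cov H K 1 x\<bar> \<le> t powr (2 * H * K) * (\<eta> * x powr (H * K))"
      by (intro mult_left_mono) auto
    moreover have "bifbm_cov H K t s = t powr (2 * H * K) * bifbm_cov H K 1 x"
      using bifbm_cov_scale[of t 1 x H K] t x sx by simp
    moreover have "(t * s) powr (H * K) = t powr (2 * H * K) * x powr (H * K)"
      using t x sx by (simp add: powr_mult flip: powr_add) (simp add: mult.assoc)
    ultimately show "\<bar>bifbm_cov H K t s\<bar> \<le> \<eta> * (t * s) powr (H * K)"
      by (simp add: abs_mult mult_ac)
  qed
qed

text \<open>The variance of \<open>X 1 - X c\<close>, computed from the covariance function, for which \<open>X 1\<close> has variance 1.\<close>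

definition incr_var :: "real \<Rightarrow> real \<Rightarrow> real \<Rightarrow> real" where
  "incr_var H K c = 1 + c powr (2 * H * K) - 2 * bifbm_cov H K 1 c"

text \<open>Near the diagonal the term \<open>\<bar>t - s\<bar> powr (2 H K)\<close> of the covariance dominates: it contributes
  \<open>2 powr (1 - K) * x powr (2 H K)\<close>.  The remaining terms equal \<open>\<psi> z\<close> with
  \<open>z = 1 - (1 - x) powr (2 H)\<close> of order \<open>x\<close>, where \<open>\<psi>\<close> vanishes to second order at 0 and \<open>2 > 2 H K\<close>.\<close>

lemma incr_var_asymptotic:
  assumes "0 < H" "0 < K" "H * K < 1"
  shows "((\<lambda>x. incr_var H K (1 - x) / x powr (2 * H * K)) \<longlongrightarrow> 2 powr (1 - K)) (at_right 0)"
proof -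
  define a b where "a = 2 * H" and "b = 2 * H * K"
  define \<psi> where "\<psi> = (\<lambda>z::real. 1 + (1 - z) powr K - 2 * (1 - z / 2) powr K)"
  define z where "z = (\<lambda>x::real. 1 - (1 - x) powr a)"
  have \<psi>: "((\<lambda>z. \<psi> z / z\<^sup>2) \<longlongrightarrow> K * (K - 1) / 4) (at_right 0)"
    unfolding \<psi>_def using assms by real_asymp
  have z0: "filterlim z (at_right 0) (at_right 0)"
    unfolding z_def a_def using assms by real_asymp
  have z1: "((\<lambda>x. z x / x) \<longlongrightarrow> a) (at_right 0)"
    unfolding z_def a_def using assms by real_asymp
  have "2 - b > 0" using assms by (simp add: b_def)
  then have "((\<lambda>x. \<psi> (z x) / (z x)\<^sup>2 * (z x / x)\<^sup>2 * x powr (2 - b) + 2 powr (1 - K))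
      \<longlongrightarrow> K * (K - 1) / 4 * a\<^sup>2 * 0 + 2 powr (1 - K)) (at_right 0)"
    by (intro tendsto_intros filterlim_compose[OF \<psi> z0] z1 powr_tendsto_0_at_right)
  moreover have "\<forall>\<^sub>F x in at_right 0.
      \<psi> (z x) / (z x)\<^sup>2 * (z x / x)\<^sup>2 * x powr (2 - b) + 2 powr (1 - K)
      = incr_var H K (1 - x) / x powr (2 * H * K)"
    using eventually_at_right_less[of "0::real"] eventually_at_right_real[of 0 "1::real", simplified]
  proof eventually_elim
    case (elim x)
    then have x: "0 < x" "x < 1" by auto
    have "(1 - x) powr a < 1" using x assms powr_less_mono2[of a "1 - x" 1] by (simp add: a_def)
    then have "z x \<noteq> 0" by (simp add: z_def)
    then have 1: "\<psi> (z x) / (z x)\<^sup>2 * (z x / x)\<^sup>2 * x powr (2 - b) = \<psi> (z x) / x powr b"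
      using x by (simp add: powr_diff power_divide)
    have "2 * (1 - z x / 2) powr K = 2 * ((1 + (1 - x) powr a) / 2) powr K"
      by (simp add: z_def field_simps)
    also have "\<dots> = 2 powr (1 - K) * (1 + (1 - x) powr a) powr K"
      using x by (simp add: powr_divide powr_diff)
    finally have "\<psi> (z x) = 1 + (1 - x) powr b - 2 powr (1 - K) * (1 + (1 - x) powr a) powr K"
      using x by (simp add: \<psi>_def z_def powr_powr a_def b_def)
    moreover have "2 * bifbm_cov H K 1 (1 - x)
        = 2 powr (1 - K) * ((1 + (1 - x) powr a) powr K - x powr b)"
      using x by (simp add: bifbm_cov_def a_def b_def powr_diff)
    ultimately have "incr_var H K (1 - x) = \<psi> (z x) + 2 powr (1 - K) * x powr b"
      unfolding incr_var_def b_def[symmetric] by (simp add: algebra_simps)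
    then show ?case
      using 1 x by (simp add: b_def[symmetric] add_divide_distrib)
  qed
  ultimately show ?thesis
    by (auto elim: Lim_transform_eventually)
qed

lemma incr_var_differ:
  assumes "0 < H1" "0 < K1" "H1 * K1 < 1" "0 < H2" "0 < K2"
    and "H1 * K1 = H2 * K2" "K1 \<noteq> K2"
  obtains c where "0 < c" "c < 1" "incr_var H1 K1 c \<noteq> incr_var H2 K2 c"
proof (rule ccontr)
  assume "\<not> thesis"
  with that have eq: "incr_var H1 K1 c = incr_var H2 K2 c" if "0 < c" "c < 1" for c
    using \<open>0 < c\<close> \<open>c < 1\<close> by blast
  have "\<forall>\<^sub>F x in at_right 0. incr_var H2 K2 (1 - x) / x powr (2 * H2 * K2)
      = incr_var H1 K1 (1 - x) / x powr (2 * H1 * K1)"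
    using eventually_at_right_real[of 0 "1::real", simplified]
    by eventually_elim (use assms(6) in \<open>simp add: eq mult.assoc\<close>)
  then have "((\<lambda>x. incr_var H1 K1 (1 - x) / x powr (2 * H1 * K1)) \<longlongrightarrow> 2 powr (1 - K2)) (at_right 0)"
    using incr_var_asymptotic[of H2 K2] assms by (auto elim: Lim_transform_eventually)
  with incr_var_asymptotic[of H1 K1] assms have "2 powr (1 - K1) = 2 powr (1 - K2)"
    by (intro tendsto_unique[OF trivial_limit_at_right_real])
  then show False using assms by (simp add: powr_inj)
qed

section \<open>Linear combinations of the coordinates\<close>

definition linear_combination :: "'i set \<Rightarrow> ('i \<Rightarrow> 'a \<Rightarrow> real) \<Rightarrow> ('a \<Rightarrow> real) \<Rightarrow> bool" where
  "linear_combination I X Y \<longleftrightarrow> (\<exists>J c. finite J \<and> J \<subseteq> I \<and> Y = (\<lambda>\<omega>. \<Sum>t\<in>J. c t * X t \<omega>))"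

lemma linear_combination_base:
  assumes "t \<in> I"
  shows "linear_combination I X (X t)"
  unfolding linear_combination_def using assms
  by (intro exI[of _ "{t}"] exI[of _ "\<lambda>_. 1"]) auto

lemma linear_combination_combine:
  assumes "linear_combination I X Y" "linear_combination I X Z"
  shows "linear_combination I X (\<lambda>\<omega>. a * Y \<omega> + b * Z \<omega>)"
proof -
  from assms obtain J c J' c' where
    J: "finite J" "J \<subseteq> I" "Y = (\<lambda>\<omega>. \<Sum>t\<in>J. c t * X t \<omega>)" and
    J': "finite J'" "J' \<subseteq> I" "Z = (\<lambda>\<omega>. \<Sum>t\<in>J'. c' t * X t \<omega>)"
    unfolding linear_combination_def by blast
  define d where "d t = a * (if t \<in> J then c t else 0) + b * (if t \<in> J' then c' t else 0)" for t
  have "a * Y \<omega> + b * Z \<omega> = (\<Sum>t\<in>J \<union> J'. d t * X t \<omega>)" for \<omega>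
  proof -
    have "Y \<omega> = (\<Sum>t\<in>J \<union> J'. (if t \<in> J then c t else 0) * X t \<omega>)"
      unfolding J(3) using J(1) J'(1) by (intro sum.mono_neutral_cong_left) auto
    moreover have "Z \<omega> = (\<Sum>t\<in>J \<union> J'. (if t \<in> J' then c' t else 0) * X t \<omega>)"
      unfolding J'(3) using J(1) J'(1) by (intro sum.mono_neutral_cong_left) auto
    ultimately show ?thesis
      by (simp only: sum_distrib_left flip: sum.distrib) (simp add: d_def algebra_simps)
  qed
  then show ?thesis
    unfolding linear_combination_def using J J' by (intro exI[of _ "J \<union> J'"] exI[of _ d]) auto
qed

locale bifbm =
  fixes M :: "'a measure" and T H K :: real and X :: "real \<Rightarrow> 'a \<Rightarrow> real"
  assumes bifbm: "bifractional_brownian_motion M T H K X"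
    and T: "0 < T" and H: "0 < H" and K: "0 < K" "K < 2" and HK: "H * K < 1"
begin

sublocale prob_space M
  using bifbm by (simp add: bifractional_brownian_motion_def gaussian_process_def)

lemma linear_combination_gaussian:
  assumes "linear_combination {0..T} X Y"
  shows "gaussian_rv M Y"
  using assms bifbm
  by (auto simp: linear_combination_def bifractional_brownian_motion_def gaussian_process_def)

lemma coordinate_centred: "t \<in> {0..T} \<Longrightarrow> expectation (X t) = 0"
  using bifbm by (simp add: bifractional_brownian_motion_def)

lemma linear_combination_centred_gaussian:
  assumes "linear_combination {0..T} X Y"
  shows "centred_gaussian M Y"
proof -
  from assms obtain J c where J: "J \<subseteq> {0..T}" and Y: "Y = (\<lambda>\<omega>. \<Sum>t\<in>J. c t * X t \<omega>)"
    by (auto simp: linear_combination_def)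
  have "integrable M (X t)" if "t \<in> {0..T}" for t
    using integrable_gaussian_power[of "X t" 1] coordinate_centred that
      linear_combination_gaussian[OF linear_combination_base] by simp
  then have "expectation Y = (\<Sum>t\<in>J. c t * expectation (X t))"
    unfolding Y using J by (subst Bochner_Integration.integral_sum) auto
  also have "\<dots> = 0"
    using J coordinate_centred by (auto intro!: sum.neutral)
  finally show ?thesis
    using linear_combination_gaussian[OF assms] by (simp add: centred_gaussian_def)
qed

lemma coordinate_measurable: "t \<in> {0..T} \<Longrightarrow> X t \<in> borel_measurable M"
  by (intro gaussian_rv_measurable linear_combination_gaussian linear_combination_base)

lemma combination_centred_gaussian:
  assumes "linear_combination {0..T} X Y" "linear_combination {0..T} X Z"
  shows "centred_gaussian M (\<lambda>\<omega>. Y \<omega> + Z \<omega>)" "centred_gaussian M (\<lambda>\<omega>. Y \<omega> - Z \<omega>)"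
  using linear_combination_combine[OF assms, of 1 1] linear_combination_combine[OF assms, of 1 "-1"]
  by (auto intro: linear_combination_centred_gaussian)

lemma coordinate_product:
  assumes "t \<in> {0..T}" "s \<in> {0..T}"
  shows coordinate_product_integrable: "integrable M (\<lambda>\<omega>. X t \<omega> * X s \<omega>)"
    and coordinate_product_expectation: "expectation (\<lambda>\<omega>. X t \<omega> * X s \<omega>) = bifbm_cov H K t s"
proof -
  note lc = linear_combination_base[OF assms(1), of X] linear_combination_base[OF assms(2), of X]
  show "integrable M (\<lambda>\<omega>. X t \<omega> * X s \<omega>)"
    by (intro integrable_gaussian_prod linear_combination_centred_gaussian
        combination_centred_gaussian lc)
  have "covariance M (X t) (X s) = bifbm_cov H K t s"
    using bifbm assms by (simp add: bifractional_brownian_motion_def)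
  then show "expectation (\<lambda>\<omega>. X t \<omega> * X s \<omega>) = bifbm_cov H K t s"
    using assms by (simp add: covariance_def coordinate_centred)
qed

lemma coordinate_variance:
  assumes "t \<in> {0..T}"
  shows "expectation (\<lambda>\<omega>. (X t \<omega>)\<^sup>2) = t powr (2 * H * K)"
  using coordinate_product_expectation[OF assms assms] assms K
  by (simp add: power2_eq_square bifbm_cov_diag)

lemma coordinate_small_prob:
  assumes "0 < t" "t \<le> T"
  shows "prob {\<omega>\<in>space M. \<bar>X t \<omega>\<bar> \<le> t powr h} \<le> t powr (h - H * K)"
proof -
  have "prob {\<omega>\<in>space M. \<bar>X t \<omega>\<bar> \<le> t powr h} \<le> t powr h / t powr (H * K)"
  proof (rule gaussian_small_ball)
    show "gaussian_rv M (X t)" "expectation (X t) = 0"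
      using linear_combination_centred_gaussian[OF linear_combination_base, of t] assms
      by (auto simp: centred_gaussian_def)
    show "expectation (\<lambda>\<omega>. (X t \<omega>)\<^sup>2) = (t powr (H * K))\<^sup>2"
      using coordinate_variance[of t] assms
      by (simp add: power2_eq_square[of "t powr (H * K)"] mult.assoc flip: powr_add)
  qed (use assms in auto)
  then show ?thesis by (simp add: powr_diff)
qed

lemma coordinate_large_prob:
  assumes "0 < t" "t \<le> T"
  shows "prob {\<omega>\<in>space M. t powr h \<le> \<bar>X t \<omega>\<bar>} \<le> t powr (2 * (H * K - h))"
proof -
  have t: "t \<in> {0..T}" using assms by simp
  have "{\<omega>\<in>space M. t powr h \<le> \<bar>X t \<omega>\<bar>} = {\<omega>\<in>space M. t powr (2 * h) \<le> (X t \<omega>)\<^sup>2}"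
  proof -
    have "t powr h \<le> \<bar>y\<bar> \<longleftrightarrow> t powr (2 * h) \<le> y\<^sup>2" for y
      using abs_le_square_iff[of "t powr h" y] by (simp add: power2_eq_square flip: powr_add)
    then show ?thesis by simp
  qed
  also have "prob \<dots> \<le> expectation (\<lambda>\<omega>. (X t \<omega>)\<^sup>2) / t powr (2 * h)"
    using coordinate_product_integrable[OF t t] assms
    by (intro integral_Markov_inequality_measure[where A="{}"]) (auto simp: power2_eq_square)
  also have "\<dots> = t powr (2 * (H * K - h))"
    using t by (simp add: coordinate_variance mult.assoc right_diff_distrib flip: powr_diff)
  finally show ?thesis .
qed

lemma path_measurable: "(\<lambda>\<omega>. \<lambda>t\<in>{0..T}. X t \<omega>) \<in> measurable M (PiM {0..T} (\<lambda>_. borel))"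
  by (intro measurable_restrict coordinate_measurable)

lemma prob_space_law: "prob_space (process_law M {0..T} X)"
  unfolding process_law_def by (rule prob_space_distr[OF path_measurable])

lemma measure_law:
  assumes "A \<in> sets (PiM {0..T} (\<lambda>_. borel))"
  shows "measure (process_law M {0..T} X) A = prob {\<omega>\<in>space M. (\<lambda>t\<in>{0..T}. X t \<omega>) \<in> A}"
  unfolding process_law_def
  by (subst measure_distr[OF path_measurable assms]) (auto intro: arg_cong[where f=prob])

end

lemma sets_process_law [simp]: "sets (process_law M I X) = sets (PiM I (\<lambda>_. borel))"
  by (simp add: process_law_def)

section \<open>Different self-similarity indices\<close>

text \<open>The test event \<open>\<bar>X t\<bar> > t powr h\<close> compares \<open>X t\<close> with a power of \<open>t\<close> that, as \<open>t\<close> tends to 0, is much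
  smaller than its standard deviation under the first law and much larger under the second.\<close>

lemma mutually_singular_of_index_less:
  assumes "bifbm M1 T H1 K1 X1" and "bifbm M2 T H2 K2 X2" and less: "H1 * K1 < H2 * K2"
  shows "mutually_singular (process_law M1 {0..T} X1) (process_law M2 {0..T} X2)"
proof -
  interpret B1: bifbm M1 T H1 K1 X1 by fact
  interpret B2: bifbm M2 T H2 K2 X2 by fact
  obtain h where h: "H1 * K1 < h" "h < H2 * K2" using dense[OF less] by blast
  show ?thesis
  proof (rule mutually_singularI_approx)
    fix \<epsilon> :: real assume \<epsilon>: "0 < \<epsilon>"
    have "\<forall>\<^sub>F t in at_right 0. t powr (h - H1 * K1) < \<epsilon>" "\<forall>\<^sub>F t in at_right 0. t powr (2 * (H2 * K2 - h)) < \<epsilon>"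
      using h \<epsilon> by (intro order_tendstoD(2)[OF powr_tendsto_0_at_right]; simp)+
    moreover have "\<forall>\<^sub>F t in at_right 0. t \<in> {0<..<T}"
      using B1.T by (rule eventually_at_right_real)
    ultimately have "\<forall>\<^sub>F t in at_right 0. t powr (h - H1 * K1) < \<epsilon> \<and> t powr (2 * (H2 * K2 - h)) < \<epsilon> \<and> t \<in> {0<..<T}"
      by eventually_elim auto
    then obtain t where t: "t powr (h - H1 * K1) < \<epsilon>" "t powr (2 * (H2 * K2 - h)) < \<epsilon>" "0 < t" "t < T"
      using eventually_happens'[OF trivial_limit_at_right_real] by auto
    let ?\<Pi> = "PiM {0..T} (\<lambda>_. borel) :: (real \<Rightarrow> real) measure"
    define A where "A = {f\<in>space ?\<Pi>. t powr h < \<bar>f t\<bar>}"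
    have tT: "t \<in> {0..T}" using t by simp
    have [measurable]: "(\<lambda>f. f t) \<in> borel_measurable ?\<Pi>"
      by (rule measurable_component_singleton[OF tT])
    have A: "A \<in> sets ?\<Pi>" unfolding A_def by measurable
    have path: "(\<lambda>u\<in>{0..T}. f u) \<in> A \<longleftrightarrow> t powr h < \<bar>f t\<bar>" for f
      using tT by (auto simp: A_def space_PiM)
    note [measurable] = B1.coordinate_measurable[OF tT] B2.coordinate_measurable[OF tT]
    have "measure (process_law M1 {0..T} X1) A = B1.prob {\<omega>\<in>space M1. t powr h < \<bar>X1 t \<omega>\<bar>}"
      by (simp add: B1.measure_law[OF A] path)
    also have "\<dots> = 1 - B1.prob {\<omega>\<in>space M1. \<bar>X1 t \<omega>\<bar> \<le> t powr h}"
      by (subst B1.prob_neg[symmetric]) (auto simp: not_le)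
    also have "\<dots> \<ge> 1 - \<epsilon>"
      using B1.coordinate_small_prob[of t h] t by simp
    finally have 1: "1 - \<epsilon> \<le> measure (process_law M1 {0..T} X1) A" .
    have "measure (process_law M2 {0..T} X2) A = B2.prob {\<omega>\<in>space M2. t powr h < \<bar>X2 t \<omega>\<bar>}"
      by (simp add: B2.measure_law[OF A] path)
    also have "\<dots> \<le> B2.prob {\<omega>\<in>space M2. t powr h \<le> \<bar>X2 t \<omega>\<bar>}"
      by (rule B2.finite_measure_mono) auto
    also have "\<dots> \<le> \<epsilon>"
      using B2.coordinate_large_prob[of t h] t by simp
    finally show "\<exists>A\<in>sets (process_law M1 {0..T} X1). 1 - \<epsilon> \<le> measure (process_law M1 {0..T} X1) A
        \<and> measure (process_law M2 {0..T} X2) A \<le> \<epsilon>"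
      using 1 A by auto
  qed (auto intro: B1.prob_space_law B2.prob_space_law)
qed

section \<open>Equal self-similarity indices\<close>

text \<open>With \<open>h = H K\<close>, self-similarity makes the law of \<open>scaled_incr h c t X\<close> the same for all \<open>t > 0\<close>.\<close>

definition scaled_incr :: "real \<Rightarrow> real \<Rightarrow> real \<Rightarrow> (real \<Rightarrow> real) \<Rightarrow> real" where
  "scaled_incr h c t f = (f t - f (c * t)) / t powr h"

definition mean_square_incr :: "real \<Rightarrow> real \<Rightarrow> real \<Rightarrow> real \<Rightarrow> nat \<Rightarrow> (real \<Rightarrow> real) \<Rightarrow> real" where
  "mean_square_incr h c T x n f = (\<Sum>k<n. (scaled_incr h c (T * x ^ k) f)\<^sup>2) / n"

context bifbm
begin

lemma scaled_incr_linear_combination: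
  assumes "0 \<le> t" "t \<le> T" "0 \<le> c" "c \<le> 1"
  shows "linear_combination {0..T} X (\<lambda>\<omega>. scaled_incr h c t (\<lambda>u. X u \<omega>))"
proof -
  have "c * t \<le> T" using assms mult_left_le_one_le[of t c] by linarith
  then have "t \<in> {0..T}" "c * t \<in> {0..T}" using assms by auto
  from linear_combination_combine[OF this[THEN linear_combination_base], of X "1 / t powr h" "- (1 / t powr h)"]
  show ?thesis by (simp add: scaled_incr_def diff_divide_distrib)
qed

lemma scaled_incr_cov:
  assumes "0 \<le> t" "t \<le> T" "0 \<le> s" "s \<le> T" "0 \<le> c" "c \<le> 1"
  shows "expectation (\<lambda>\<omega>. scaled_incr h c t (\<lambda>u. X u \<omega>) * scaled_incr h c s (\<lambda>u. X u \<omega>)) =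
    (bifbm_cov H K t s - bifbm_cov H K t (c * s) - bifbm_cov H K (c * t) s + bifbm_cov H K (c * t) (c * s))
      / (t * s) powr h"
proof -
  have "c * t \<le> T" "c * s \<le> T"
    using assms mult_left_le_one_le[of t c] mult_left_le_one_le[of s c] by linarith+
  then have [simp]: "t \<in> {0..T}" "c * t \<in> {0..T}" "s \<in> {0..T}" "c * s \<in> {0..T}"
    using assms by auto
  note [simp] = coordinate_product_integrable
  have "expectation (\<lambda>\<omega>. scaled_incr h c t (\<lambda>u. X u \<omega>) * scaled_incr h c s (\<lambda>u. X u \<omega>))
     = expectation (\<lambda>\<omega>. (X t \<omega> * X s \<omega> - X t \<omega> * X (c * s) \<omega> - X (c * t) \<omega> * X s \<omega>
        + X (c * t) \<omega> * X (c * s) \<omega>) / (t * s) powr h)"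
    using assms by (simp add: scaled_incr_def powr_mult algebra_simps)
  also have "\<dots> = (bifbm_cov H K t s - bifbm_cov H K t (c * s) - bifbm_cov H K (c * t) s
      + bifbm_cov H K (c * t) (c * s)) / (t * s) powr h"
    by (simp add: coordinate_product_expectation del: atLeastAtMost_iff)
  finally show ?thesis .
qed

lemma scaled_incr_variance:
  assumes "0 < t" "t \<le> T" "0 \<le> c" "c \<le> 1"
  shows "expectation (\<lambda>\<omega>. (scaled_incr (H * K) c t (\<lambda>u. X u \<omega>))\<^sup>2) = incr_var H K c"
proof -
  have R: "bifbm_cov H K t t = t powr (2 * H * K)"
    "bifbm_cov H K t (c * t) = t powr (2 * H * K) * bifbm_cov H K 1 c"
    "bifbm_cov H K (c * t) (c * t) = t powr (2 * H * K) * c powr (2 * H * K)"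
    using assms K bifbm_cov_scale[of t 1 1 H K] bifbm_cov_scale[of t 1 c H K] bifbm_cov_scale[of t c c H K]
    by (simp_all add: bifbm_cov_diag mult.commute[of t])
  have "expectation (\<lambda>\<omega>. (scaled_incr (H * K) c t (\<lambda>u. X u \<omega>))\<^sup>2)
      = t powr (2 * H * K) * incr_var H K c / (t * t) powr (H * K)"
    unfolding power2_eq_square using assms
    by (simp add: scaled_incr_cov bifbm_cov_commute[of H K "c * t" t] R incr_var_def algebra_simps)
  also have "(t * t) powr (H * K) = t powr (2 * H * K)"
    using assms by (simp add: powr_mult mult.assoc flip: powr_add)
  finally show ?thesis using assms by simp
qed

text \<open>The covariance of two rescaled increments is a signed sum of four covariances of \<open>X\<close> at the times
  \<open>t\<close> or \<open>c t\<close> and \<open>s\<close> or \<open>c s\<close>, each of which is small relative to \<open>(t s) powr (H K)\<close> when \<open>s / t\<close> is.\<close>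

lemma scaled_incr_decorrelate:
  assumes c: "0 < c" "c < 1" and \<delta>: "0 < \<delta>"
  obtains x\<^sub>0 where "0 < x\<^sub>0"
    "\<And>t s. 0 < s \<Longrightarrow> s < x\<^sub>0 * t \<Longrightarrow> s \<le> T \<Longrightarrow> t \<le> T \<Longrightarrow>
      \<bar>expectation (\<lambda>\<omega>. scaled_incr (H * K) c t (\<lambda>u. X u \<omega>) * scaled_incr (H * K) c s (\<lambda>u. X u \<omega>))\<bar> \<le> \<delta>"
proof -
  define h where "h = H * K"
  have h: "0 < h" using H K by (simp add: h_def)
  obtain y where y: "0 < y"
    and R: "\<And>t s. 0 < s \<Longrightarrow> s < y * t \<Longrightarrow> \<bar>bifbm_cov H K t s\<bar> \<le> \<delta> / 4 * (t * s) powr h"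
    using bifbm_cov_decay[OF H K HK, of "\<delta> / 4"] \<delta> unfolding h_def by auto
  show ?thesis
    \<comment> \<open>Of the four pairs of times, the largest ratio is \<open>s / (c * t)\<close>; it has to stay below \<open>y\<close>.\<close>
  proof (rule that[of "c * y"])
    fix t s assume s: "0 < s" "s < c * y * t" "s \<le> T" "t \<le> T"
    have t: "0 < t" using s y c by (metis less_trans mult_pos_pos zero_less_mult_pos)
    have lt: "c * s < s" "s < y * (c * t)" "y * (c * t) < y * t"
      using c s t y by (auto simp: mult_ac)
    then have lt': "s < y * t" "c * s < y * t" "c * s < y * (c * t)" by linarith+
    have shrink: "\<delta> / 4 * u powr h \<le> \<delta> / 4 * (t * s) powr h" if "0 \<le> u" "u \<le> t * s" for u
      using that h \<delta> by (intro mult_left_mono powr_mono2) auto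
    have "c * (t * s) \<le> t * s" "c * (c * (t * s)) \<le> t * s"
      using c s t mult_left_le_one_le[of "t * s" c] mult_left_le_one_le[of "t * s" "c * c"]
      by (auto simp: mult_le_one mult.assoc)
    then have "t * (c * s) \<le> t * s" "c * t * s \<le> t * s" "c * t * (c * s) \<le> t * s"
      by (simp_all add: mult_ac)
    note bounds = order_trans[OF R shrink[OF _ this(1)]] order_trans[OF R shrink[OF _ this(2)]]
      order_trans[OF R shrink[OF _ this(3)]]
    have "\<bar>bifbm_cov H K t s\<bar> \<le> \<delta> / 4 * (t * s) powr h"
      using s by (intro R lt') auto
    moreover have "\<bar>bifbm_cov H K t (c * s)\<bar> \<le> \<delta> / 4 * (t * s) powr h"
      using s t c by (intro bounds(1) lt') auto
    moreover have "\<bar>bifbm_cov H K (c * t) s\<bar> \<le> \<delta> / 4 * (t * s) powr h"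
      using s t c by (intro bounds(2) lt) auto
    moreover have "\<bar>bifbm_cov H K (c * t) (c * s)\<bar> \<le> \<delta> / 4 * (t * s) powr h"
      using s t c by (intro bounds(3) lt') auto
    ultimately have "\<bar>bifbm_cov H K t s - bifbm_cov H K t (c * s) - bifbm_cov H K (c * t) s
        + bifbm_cov H K (c * t) (c * s)\<bar> \<le> \<delta> * (t * s) powr h"
      by linarith
    then show "\<bar>expectation (\<lambda>\<omega>. scaled_incr (H * K) c t (\<lambda>u. X u \<omega>) * scaled_incr (H * K) c s (\<lambda>u. X u \<omega>))\<bar> \<le> \<delta>"
      using s t c by (simp add: scaled_incr_cov h_def[symmetric] abs_divide pos_divide_le_eq)
  qed (use c y in auto)
qed

lemma mean_square_incr_concentration:
  assumes c: "0 < c" "c < 1" and e: "0 < e" and \<epsilon>: "0 < \<epsilon>"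
  shows "\<forall>\<^sub>F n in sequentially. \<forall>\<^sub>F x in at_right 0.
    prob {\<omega>\<in>space M. e \<le> \<bar>mean_square_incr (H * K) c T x n (\<lambda>u. X u \<omega>) - incr_var H K c\<bar>} \<le> \<epsilon>"
proof -
  define v where "v = incr_var H K c"
  \<comment> \<open>Both \<open>\<delta>\<close> and \<open>N\<close> are chosen so that each of the two terms of the Chebyshev bound is at most \<open>\<epsilon> / 2\<close>.\<close>
  define \<delta> where "\<delta> = e * sqrt \<epsilon> / 2"
  have \<delta>: "0 < \<delta>" "2 * \<delta>\<^sup>2 = e\<^sup>2 * \<epsilon> / 2"
    using e \<epsilon> by (simp_all add: \<delta>_def power_divide power_mult_distrib)
  obtain y where y: "0 < y"
    and cov: "\<And>t s. 0 < s \<Longrightarrow> s < y * t \<Longrightarrow> s \<le> T \<Longrightarrow> t \<le> T \<Longrightarrow>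
      \<bar>expectation (\<lambda>\<omega>. scaled_incr (H * K) c t (\<lambda>u. X u \<omega>) * scaled_incr (H * K) c s (\<lambda>u. X u \<omega>))\<bar> \<le> \<delta>"
    using scaled_incr_decorrelate[OF c \<delta>(1)] by blast
  obtain N :: nat where N: "4 * v\<^sup>2 / (e\<^sup>2 * \<epsilon>) < N"
    using reals_Archimedean2 by blast
  show ?thesis
    unfolding eventually_sequentially eventually_at_right_field
  proof (intro exI[of _ "Suc N"] exI[of _ "min 1 y"] allI impI conjI)
    fix n x assume n: "Suc N \<le> n" and x: "0 < x" "x < min 1 y"
    have t: "0 < T * x ^ k" "T * x ^ k \<le> T" for k
      using T x by (auto simp: power_le_one mult_left_le)
    note lc = scaled_incr_linear_combination[OF less_imp_le[OF t(1)] t(2) less_imp_le[OF c(1)] less_imp_le[OF c(2)]]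
    have "prob {\<omega>\<in>space M. e \<le> \<bar>(\<Sum>k<n. (scaled_incr (H * K) c (T * x ^ k) (\<lambda>u. X u \<omega>))\<^sup>2) / n - v\<bar>}
        \<le> (2 * v\<^sup>2 / n + 2 * \<delta>\<^sup>2) / e\<^sup>2"
    proof (rule gaussian_mean_square_concentration)
      fix i j :: nat assume "i < j"
      then obtain m where "j = Suc (i + m)"
        using less_imp_Suc_add by blast
      then have "T * x ^ j = T * x ^ i * x ^ m * x"
        by (simp add: power_add)
      also have "\<dots> \<le> T * x ^ i * 1 * x"
        using T x by (intro mult_mono power_le_one) auto
      also have "\<dots> < y * (T * x ^ i)"
        using mult_strict_right_mono[of x y "T * x ^ i"] t(1)[of i] x by (simp add: mult_ac)
      finally show "\<bar>expectation (\<lambda>\<omega>. scaled_incr (H * K) c (T * x ^ i) (\<lambda>u. X u \<omega>) *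
          scaled_incr (H * K) c (T * x ^ j) (\<lambda>u. X u \<omega>))\<bar> \<le> \<delta>"
        by (intro cov t)
    qed (use n e c t in \<open>auto simp: v_def scaled_incr_variance intro!:
        linear_combination_centred_gaussian[OF lc] combination_centred_gaussian[OF lc lc]\<close>)
    also have "\<dots> \<le> \<epsilon>"
    proof -
      have "0 < real n" "4 * v\<^sup>2 / (e\<^sup>2 * \<epsilon>) \<le> real n" using n N by linarith+
      then have "2 * v\<^sup>2 / n \<le> e\<^sup>2 * \<epsilon> / 2"
        using e \<epsilon> by (simp add: field_simps)
      then have "2 * v\<^sup>2 / n + 2 * \<delta>\<^sup>2 \<le> e\<^sup>2 * \<epsilon>"
        using \<delta>(2) by linarith
      then show ?thesis using e by (simp add: pos_divide_le_eq mult.commute)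
    qed
    finally show "prob {\<omega>\<in>space M. e \<le> \<bar>mean_square_incr (H * K) c T x n (\<lambda>u. X u \<omega>) - incr_var H K c\<bar>} \<le> \<epsilon>"
      by (simp add: mean_square_incr_def v_def)
  qed (use y in auto)
qed

end

text \<open>The test event is that the empirical mean of the squared rescaled increments lies closer to the first
  variance than half the distance between the two variances.\<close>

lemma mutually_singular_of_index_eq:
  assumes "bifbm M1 T H1 K1 X1" and "bifbm M2 T H2 K2 X2"
    and eq: "H1 * K1 = H2 * K2" and K: "K1 \<noteq> K2"
  shows "mutually_singular (process_law M1 {0..T} X1) (process_law M2 {0..T} X2)"
proof -
  interpret B1: bifbm M1 T H1 K1 X1 by fact
  interpret B2: bifbm M2 T H2 K2 X2 by fact
  obtain c where c: "0 < c" "c < 1" and ne: "incr_var H1 K1 c \<noteq> incr_var H2 K2 c"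
    using incr_var_differ[OF B1.H B1.K(1) B1.HK B2.H B2.K(1) eq K] .
  define v1 v2 e where "v1 = incr_var H1 K1 c" and "v2 = incr_var H2 K2 c" and "e = \<bar>v1 - v2\<bar> / 2"
  have e: "0 < e" using ne by (simp add: v1_def v2_def e_def)
  show ?thesis
  proof (rule mutually_singularI_approx)
    fix \<epsilon> :: real assume \<epsilon>: "0 < \<epsilon>"
    have "\<forall>\<^sub>F n in sequentially. \<forall>\<^sub>F x in at_right 0. x \<in> {0<..<1} \<and>
        B1.prob {\<omega>\<in>space M1. e \<le> \<bar>mean_square_incr (H1 * K1) c T x n (\<lambda>u. X1 u \<omega>) - v1\<bar>} \<le> \<epsilon> \<and>
        B2.prob {\<omega>\<in>space M2. e \<le> \<bar>mean_square_incr (H2 * K2) c T x n (\<lambda>u. X2 u \<omega>) - v2\<bar>} \<le> \<epsilon>"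
      using B1.mean_square_incr_concentration[OF c e \<epsilon>] B2.mean_square_incr_concentration[OF c e \<epsilon>]
      unfolding v1_def v2_def
      by eventually_elim
         (simp only: eventually_conj_iff eventually_at_right_real[OF zero_less_one] simp_thms)
    then obtain n x where x: "0 < x" "x < 1"
      and V: "B1.prob {\<omega>\<in>space M1. e \<le> \<bar>mean_square_incr (H1 * K1) c T x n (\<lambda>u. X1 u \<omega>) - v1\<bar>} \<le> \<epsilon>"
        "B2.prob {\<omega>\<in>space M2. e \<le> \<bar>mean_square_incr (H2 * K2) c T x n (\<lambda>u. X2 u \<omega>) - v2\<bar>} \<le> \<epsilon>"
      by (auto dest!: eventually_happens'[OF sequentially_bot] eventually_happens'[OF trivial_limit_at_right_real])
    define V where "V = mean_square_incr (H1 * K1) c T x n"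
    have V1: "B1.prob {\<omega>\<in>space M1. e \<le> \<bar>V (\<lambda>u. X1 u \<omega>) - v1\<bar>} \<le> \<epsilon>"
      and V2: "B2.prob {\<omega>\<in>space M2. e \<le> \<bar>V (\<lambda>u. X2 u \<omega>) - v2\<bar>} \<le> \<epsilon>"
      using V by (simp_all add: V_def eq)
    let ?\<Pi> = "PiM {0..T} (\<lambda>_. borel) :: (real \<Rightarrow> real) measure"
    have t: "T * x ^ k \<in> {0..T}" "c * (T * x ^ k) \<in> {0..T}" for k
    proof -
      show *: "T * x ^ k \<in> {0..T}"
        using B1.T x by (auto simp: power_le_one mult_left_le)
      show "c * (T * x ^ k) \<in> {0..T}"
        using c * mult_left_le_one_le[of "T * x ^ k" c] by auto
    qed
    have V_meas [measurable]: "V \<in> borel_measurable ?\<Pi>"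
      unfolding V_def mean_square_incr_def[abs_def] scaled_incr_def
      by (intro borel_measurable_divide borel_measurable_sum borel_measurable_power
          borel_measurable_diff measurable_component_singleton t) auto
    have V_restrict: "V (\<lambda>u\<in>{0..T}. f u) = V f" for f
      using t by (simp add: V_def mean_square_incr_def scaled_incr_def del: atLeastAtMost_iff)
    have V_comp [measurable]: "(\<lambda>\<omega>. V (\<lambda>u. X1 u \<omega>)) \<in> borel_measurable M1"
      "(\<lambda>\<omega>. V (\<lambda>u. X2 u \<omega>)) \<in> borel_measurable M2"
      using measurable_compose[OF B1.path_measurable V_meas]
        measurable_compose[OF B2.path_measurable V_meas] by (simp_all add: V_restrict)
    define A where "A = {f\<in>space ?\<Pi>. \<bar>V f - v1\<bar> < e}"
    have A: "A \<in> sets ?\<Pi>" unfolding A_def by measurable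
    have path: "(\<lambda>u\<in>{0..T}. f u) \<in> A \<longleftrightarrow> \<bar>V f - v1\<bar> < e" for f
      by (auto simp: A_def space_PiM V_restrict)
    have "measure (process_law M1 {0..T} X1) A = B1.prob {\<omega>\<in>space M1. \<bar>V (\<lambda>u. X1 u \<omega>) - v1\<bar> < e}"
      by (simp add: B1.measure_law[OF A] path)
    also have "\<dots> = 1 - B1.prob {\<omega>\<in>space M1. e \<le> \<bar>V (\<lambda>u. X1 u \<omega>) - v1\<bar>}"
      by (subst B1.prob_neg[symmetric]) (auto simp: not_le)
    also have "\<dots> \<ge> 1 - \<epsilon>" using V1 by simp
    finally have 1: "1 - \<epsilon> \<le> measure (process_law M1 {0..T} X1) A" .
    have "measure (process_law M2 {0..T} X2) A = B2.prob {\<omega>\<in>space M2. \<bar>V (\<lambda>u. X2 u \<omega>) - v1\<bar> < e}"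
      by (simp add: B2.measure_law[OF A] path)
    also have "\<dots> \<le> B2.prob {\<omega>\<in>space M2. e \<le> \<bar>V (\<lambda>u. X2 u \<omega>) - v2\<bar>}"
      by (rule B2.finite_measure_mono) (auto simp: e_def abs_if field_simps split: if_splits)
    also have "\<dots> \<le> \<epsilon>" by (rule V2)
    finally show "\<exists>A\<in>sets (process_law M1 {0..T} X1). 1 - \<epsilon> \<le> measure (process_law M1 {0..T} X1) A
        \<and> measure (process_law M2 {0..T} X2) A \<le> \<epsilon>"
      using 1 A by auto
  qed (auto intro: B1.prob_space_law B2.prob_space_law)
qed

section \<open>Singularity of the two laws\<close>

theorem theorem5p1:
  fixes T H1 K1 H2 K2 :: real
    and M1 :: "'a measure" and M2 :: "'b measure"
    and X1 :: "real \<Rightarrow> 'a \<Rightarrow> real" and X2 :: "real \<Rightarrow> 'b \<Rightarrow> real"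
  assumes "T > 0"
    and "H1 \<in> {0<..<1}" and "K1 \<in> {0<..<2}" and "H1 * K1 \<in> {0<..<1}"
    and "H2 \<in> {0<..<1}" and "K2 \<in> {0<..<2}" and "H2 * K2 \<in> {0<..<1}"
    and "bifractional_brownian_motion M1 T H1 K1 X1"
    and "bifractional_brownian_motion M2 T H2 K2 X2"
    and "bifbm_gamma H1 K1 = bifbm_gamma H2 K2"
    and "K1 \<noteq> K2"
  shows "mutually_singular (process_law M1 {0..T} X1) (process_law M2 {0..T} X2)"
proof -
  have B: "bifbm M1 T H1 K1 X1" "bifbm M2 T H2 K2 X2"
    using assms by (auto simp: bifbm_def)
  show ?thesis
  proof (cases "H1 * K1" "H2 * K2" rule: linorder_cases)
    case less
    with B show ?thesis by (rule mutually_singular_of_index_less)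
  next
    case equal
    with B show ?thesis using \<open>K1 \<noteq> K2\<close> by (rule mutually_singular_of_index_eq)
  next
    case greater
    with B show ?thesis
      by (intro mutually_singular_commute[OF mutually_singular_of_index_less])
  qed
qed

end
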